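(* In $\mathsf{ZFC}$, $\mathfrak{b}(\mathbf{R}_\exists^{\mathrm{bd}})=\mathfrak{d}$ and $\mathfrak{d}(\mathbf{R}_\exists^{\mathrm{bd}})=\mathfrak{b}$, and $\mathfrak{d}(\mathbf{R}_\forall^{\mathrm{bd}})=\mathfrak{d}$ and $\mathfrak{b}(\mathbf{R}_\forall^{\mathrm{bd}})=\mathfrak{b}$.
   Context: A relational system $\mathbf{R}=\langle X,Y,\sqsubset\rangle$ consists of two non-empty sets $X,Y$ and a relation $\sqsubset$ between elements of $X$ and elements of $Y$. A set $F\subseteq X$ is $\mathbf{R}$-bounded if $\exists y\in Y\,\forall x\in F\; x\sqsubset y$, and $\mathbf{R}$-unbounded otherwise; $E\subseteq Y$ is $\mathbf{R}$-dominating if $\forall x\in X\,\exists y\in E\; x\sqsubset y$. Put $\mathfrak{b}(\mathbf{R})=\min\{|F|: F\subseteq X \text{ is } \mathbf{R}\text{-unbounded}\}$ and $\mathfrak{d}(\mathbf{R})=\min\{|D|: D\subseteq Y\text{ is }\mathbf{R}\text{-dominating}\}$. $\omega^{\uparrow\omega}$ is the set of strictly increasing functions $\omega\to\omega$; $[\omega]^\omega$ is the set of infinite subsets of $\omega$; $[a,b)=\{m\in\omega: a\le m<b\}$; $\forall^\infty n$ means "for all but finitely many $n\in\omega$", $\exists^\infty n$ means "for infinitely many $n\in\omega$". $\mathfrak{b}$ and $\mathfrak{d}$ denote $\mathfrak{b}(\mathbf{D})$ and $\mathfrak{d}(\mathbf{D})$ for $\mathbf{D}=\langle\omega^{\uparrow\omega},\omega^{\uparrow\omega},\le^*\rangle$,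 where $x\le^* y$ means $\forall^\infty n\; x(n)\le y(n)$. $\omega^\omega_\uparrow=\{f\in\omega^\omega: f(n+1)-f(n)\to\infty\text{ as }n\to\infty\}$. For $\iota\in\{\forall,\exists\}$, $\mathbf{R}_\iota^{\mathrm{bd}}=\langle\omega^\omega_\uparrow,[\omega]^\omega,\sqsubset_\iota^{\mathrm{bd}}\rangle$, where $f\sqsubset_\iota^{\mathrm{bd}}X$ iff $\exists k\in\omega\;\iota^\infty n\; |[f(n),f(n+1))\cap X|\le k$. *)

theory Defs
  imports Complex_Main "HOL-Library.Infinite_Set"
begin

unbundle cardinal_syntax

text \<open>
  Cardinals are the library's cardinal orders \<open>|A|\<close>, compared by \<open>\<le>o\<close> and \<open>=o\<close>. Cardinal orders over
  different types are never equal as terms, and over the same type only if they are the same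
  well-order, so equality of cardinals is \<open>=o\<close> throughout.
\<close>

definition min_card :: "'a set set \<Rightarrow> 'a rel" where
  "min_card \<A> = |SOME A. A \<in> \<A> \<and> (\<forall>B\<in>\<A>. |A| \<le>o |B| )|"

lemma min_card:
  assumes "\<A> \<noteq> {}"
  shows "\<exists>A\<in>\<A>. min_card \<A> = |A|" and "\<forall>B\<in>\<A>. min_card \<A> \<le>o |B|"
proof -
  have "\<exists>r\<in>card_of ` \<A>. \<forall>r'\<in>card_of ` \<A>. r \<le>o r'"
    by (rule exists_minim_Card_order) (use assms card_of_Card_order in auto)
  then have "\<exists>A. A \<in> \<A> \<and> (\<forall>B\<in>\<A>. |A| \<le>o |B| )" by blast
  from someI_ex[OF this]
  show "\<exists>A\<in>\<A>. min_card \<A> = |A|" and "\<forall>B\<in>\<A>. min_card \<A> \<le>o |B|"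
    unfolding min_card_def by blast+
qed

type_synonym ('a, 'b) relsys = "'a set \<times> 'b set \<times> ('a \<Rightarrow> 'b \<Rightarrow> bool)"

fun relational_system :: "('a, 'b) relsys \<Rightarrow> bool" where
  "relational_system (X, Y, R) \<longleftrightarrow> X \<noteq> {} \<and> Y \<noteq> {}"

fun bounded_in :: "('a, 'b) relsys \<Rightarrow> 'a set \<Rightarrow> bool" where
  "bounded_in (X, Y, R) F \<longleftrightarrow> F \<subseteq> X \<and> (\<exists>y\<in>Y. \<forall>x\<in>F. R x y)"

fun unbounded_in :: "('a, 'b) relsys \<Rightarrow> 'a set \<Rightarrow> bool" where
  "unbounded_in (X, Y, R) F \<longleftrightarrow> F \<subseteq> X \<and> \<not> bounded_in (X, Y, R) F"

fun dominating_in :: "('a, 'b) relsys \<Rightarrow> 'b set \<Rightarrow> bool" where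
  "dominating_in (X, Y, R) E \<longleftrightarrow> E \<subseteq> Y \<and> (\<forall>x\<in>X. \<exists>y\<in>E. R x y)"

definition b_num :: "('a, 'b) relsys \<Rightarrow> 'a rel" where
  "b_num S = min_card {F. unbounded_in S F}"

definition d_num :: "('a, 'b) relsys \<Rightarrow> 'b rel" where
  "d_num S = min_card {E. dominating_in S E}"

definition D_sys :: "(nat \<Rightarrow> nat, nat \<Rightarrow> nat) relsys" where
  "D_sys = ({x. strict_mono x}, {y. strict_mono y}, \<lambda>x y. \<forall>\<^sub>\<infinity>n. x n \<le> y n)"

text \<open>The differences are taken in the integers, since \<open>f\<close> may decrease at finitely many places.\<close>

definition omega_up :: "(nat \<Rightarrow> nat) set" where
  "omega_up = {f. filterlim (\<lambda>n. int (f (Suc n)) - int (f n)) at_top sequentially}"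

definition R_all_bd :: "(nat \<Rightarrow> nat, nat set) relsys" where
  "R_all_bd = (omega_up, {A. infinite A},
     \<lambda>f A. \<exists>k. \<forall>\<^sub>\<infinity>n. card ({f n..<f (Suc n)} \<inter> A) \<le> k)"

definition R_ex_bd :: "(nat \<Rightarrow> nat, nat set) relsys" where
  "R_ex_bd = (omega_up, {A. infinite A},
     \<lambda>f A. \<exists>k. \<exists>\<^sub>\<infinity>n. card ({f n..<f (Suc n)} \<inter> A) \<le> k)"

text \<open>
  The minima defining \<open>b_num\<close> and \<open>d_num\<close> are taken over nonempty families for the three systems
  above, so the choice in \<open>min_card\<close> always picks an actual minimum.
\<close>

lemma unbounded_D_sys: "unbounded_in D_sys {x. strict_mono x}"
proof -
  have "\<exists>x::nat \<Rightarrow> nat. strict_mono x \<and> \<not> (\<forall>\<^sub>\<infinity>n. x n \<le> y n)" if "strict_mono y" for y :: "nat \<Rightarrow> nat"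
  proof (intro exI conjI)
    show "strict_mono (\<lambda>n. Suc (y n))" using that by (auto simp: strict_mono_def)
  qed simp
  then show ?thesis by (auto simp: D_sys_def)
qed

lemma dominating_D_sys: "dominating_in D_sys {y. strict_mono y}"
  by (auto simp: D_sys_def)

lemma ex_large_blocks:
  assumes "infinite A"
  shows "\<exists>f\<in>omega_up. \<forall>n. n \<le> card ({f n..<f (Suc n)} \<inter> A)"
proof -
  define t where "t n = (\<Sum>i<n. i)" for n :: nat
  define f where "f n = enumerate A (t n)" for n
  have sm: "strict_mono (enumerate A)" using assms by (rule strict_mono_enumerate)
  have blocks: "n \<le> card ({f n..<f (Suc n)} \<inter> A)" for n
  proof -
    have "enumerate A ` {t n..<t (Suc n)} \<subseteq> {f n..<f (Suc n)} \<inter> A"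
      using sm assms by (auto simp: f_def strict_mono_less strict_mono_less_eq enumerate_in_set)
    then have "card (enumerate A ` {t n..<t (Suc n)}) \<le> card ({f n..<f (Suc n)} \<inter> A)"
      by (intro card_mono) auto
    moreover have "card (enumerate A ` {t n..<t (Suc n)}) = n"
      by (subst card_image) (use strict_mono_imp_inj_on[OF sm] in \<open>auto simp: t_def intro: inj_on_subset\<close>)
    ultimately show ?thesis by simp
  qed
  have "int n \<le> int (f (Suc n)) - int (f n)" for n
  proof -
    have "card ({f n..<f (Suc n)} \<inter> A) \<le> card {f n..<f (Suc n)}" by (intro card_mono) auto
    moreover have "f n \<le> f (Suc n)"
      using sm by (auto simp: f_def t_def strict_mono_less_eq)
    ultimately show ?thesis using blocks[of n] by simp
  qed
  then have "f \<in> omega_up"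
    unfolding omega_up_def
    by (auto intro: filterlim_at_top_mono[OF filterlim_int_sequentially])
  with blocks show ?thesis by blast
qed

lemma ex_sparse_set:
  assumes "f \<in> omega_up"
  shows "\<exists>A. infinite A \<and> (\<forall>\<^sub>\<infinity>n. card ({f n..<f (Suc n)} \<inter> A) \<le> 1)"
proof -
  from assms have "\<forall>\<^sub>F n in sequentially. 1 \<le> int (f (Suc n)) - int (f n)"
    by (auto simp: omega_up_def filterlim_at_top)
  then obtain N where N: "f n < f (Suc n)" if "n \<ge> N" for n
    by (force simp: eventually_sequentially)
  have sm: "f m < f n" if "N \<le> m" "m < n" for m n
    using that(2,1) by (induction rule: strict_inc_induct) (auto intro: N less_trans)
  then have inj: "inj_on f {N..}"
    by (intro linorder_inj_onI) (auto dest: less_imp_neq)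
  have "{f n..<f (Suc n)} \<inter> f ` {N..} \<subseteq> {f n}" if "n \<ge> N" for n
  proof (clarsimp)
    fix m assume m: "N \<le> m" "f n \<le> f m" "f m < f (Suc n)"
    have "\<not> m < n" using sm[of m n] m by auto
    moreover have "\<not> Suc n < m" using sm[of "Suc n" m] m that by auto
    moreover have "m \<noteq> Suc n" using m by auto
    ultimately show "f m = f n" by (metis linorder_neqE_nat Suc_lessI)
  qed
  then have "card ({f n..<f (Suc n)} \<inter> f ` {N..}) \<le> 1" if "n \<ge> N" for n
    using that card_mono[of "{f n}"] by fastforce
  then have "\<forall>\<^sub>\<infinity>n. card ({f n..<f (Suc n)} \<inter> f ` {N..}) \<le> 1"
    unfolding MOST_nat_le by blast
  moreover have "infinite (f ` {N..})"
    using finite_image_iff[OF inj] infinite_Ici by blast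
  ultimately show ?thesis by blast
qed

lemma unbounded_R_ex_bd: "unbounded_in R_ex_bd omega_up"
proof -
  have "\<exists>f\<in>omega_up. \<forall>k. \<forall>\<^sub>\<infinity>n. \<not> card ({f n..<f (Suc n)} \<inter> A) \<le> k" if A: "infinite A" for A
  proof -
    obtain f where f: "f \<in> omega_up" "\<And>n. n \<le> card ({f n..<f (Suc n)} \<inter> A)"
      using ex_large_blocks[OF A] by blast
    have "\<forall>\<^sub>\<infinity>n. \<not> card ({f n..<f (Suc n)} \<inter> A) \<le> k" for k
      unfolding MOST_nat using f(2) by (meson leD le_trans not_le_imp_less)
    with f(1) show ?thesis by blast
  qed
  then show ?thesis by (simp add: R_ex_bd_def not_le, blast)
qed

lemma unbounded_R_all_bd: "unbounded_in R_all_bd omega_up"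
proof -
  have "(\<exists>\<^sub>\<infinity>n. P n)" if "\<forall>\<^sub>\<infinity>n. P n" for P :: "nat \<Rightarrow> bool"
    using that by (intro MOST_INFM) auto
  then show ?thesis
    using unbounded_R_ex_bd unfolding R_ex_bd_def R_all_bd_def by simp meson
qed

lemma dominating_R_all_bd: "dominating_in R_all_bd {A. infinite A}"
  using ex_sparse_set unfolding R_all_bd_def by (simp, blast)

lemma dominating_R_ex_bd: "dominating_in R_ex_bd {A. infinite A}"
proof -
  have "(\<exists>\<^sub>\<infinity>n. P n)" if "\<forall>\<^sub>\<infinity>n. P n" for P :: "nat \<Rightarrow> bool"
    using that by (intro MOST_INFM) auto
  then show ?thesis
    using dominating_R_all_bd unfolding R_ex_bd_def R_all_bd_def by simp meson
qed

lemma relational_systems: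
  "relational_system D_sys" "relational_system R_all_bd" "relational_system R_ex_bd"
proof -
  have "strict_mono (id :: nat \<Rightarrow> nat)" by (simp add: strict_mono_def)
  then show "relational_system D_sys" by (auto simp: D_sys_def)
  have "omega_up \<noteq> {}" using ex_large_blocks[of UNIV] by auto
  then show "relational_system R_all_bd" "relational_system R_ex_bd"
    using infinite_UNIV_nat by (auto simp: R_all_bd_def R_ex_bd_def)
qed

end

theory Submission
  imports Defs
begin

text \<open>
  The system \<open>R_all_bd\<close> is Tukey equivalent to \<open>D_sys\<close>, and \<open>R_ex_bd\<close> is Tukey equivalent to the
  dual of \<open>D_sys\<close>. A Tukey connection
  compares both cardinal invariants (\<open>tukey_le_invariants\<close>), and dualising exchanges them, so the four
  equalities follow.

  Two observations give all four connections.

  First, a strictly increasing \<open>y\<close> yields the sparse infinite set of iterates of \<open>m \<mapsto> y m + 1\<close>, which has at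
  most one point in every interval \<open>[l, y l]\<close>. Let \<open>x\<close> outgrow \<open>f\<close>, meaning that \<open>x (f n) \<ge> f (n + 1)\<close>
  for all \<open>n\<close> and that every \<open>[m, x m)\<close> contains an interval of \<open>f\<close> with late index. If \<open>y\<close>
  eventually dominates \<open>x\<close>, then almost every interval of \<open>f\<close> has at most one point of the sparse set;
  if \<open>y\<close> merely exceeds \<open>x\<close> infinitely often, then infinitely many do.

  Second, an infinite set \<open>A\<close> yields the function \<open>m \<mapsto> enumerate A (2 m)\<close>, for which \<open>[m, enumerate A (2 m))\<close>
  has at least \<open>m\<close> points of \<open>A\<close>. Let \<open>f\<close> grow so that \<open>f (n + 1) \<ge> x (f n)\<close>. If \<open>x\<close> eventually
  dominates the function of \<open>A\<close>, then the counts of \<open>A\<close> in the intervals of \<open>f\<close> tend to infinity. If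
  \<open>x\<close> exceeds it at infinitely many \<open>m\<close>, then \<open>[m, x m)\<close> is covered by two consecutive intervals of \<open>f\<close>,
  so the counts are unbounded.
\<close>

section \<open>Tukey connections and their effect on the invariants\<close>

fun tukey_le :: "('a, 'b) relsys \<Rightarrow> ('c, 'd) relsys \<Rightarrow> bool" where
  "tukey_le (X, Y, R) (X', Y', R') \<longleftrightarrow>
     (\<exists>\<phi> \<psi>. (\<forall>x\<in>X. \<phi> x \<in> X') \<and> (\<forall>y\<in>Y'. \<psi> y \<in> Y) \<and>
            (\<forall>x\<in>X. \<forall>y\<in>Y'. R' (\<phi> x) y \<longrightarrow> R x (\<psi> y)))"

fun dual :: "('a, 'b) relsys \<Rightarrow> ('b, 'a) relsys" where
  "dual (X, Y, R) = (Y, X, \<lambda>y x. \<not> R x y)"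

lemma unbounded_in_dual: "unbounded_in (dual S) F \<longleftrightarrow> dominating_in S F"
  by (cases S) auto

lemma dominating_in_dual: "dominating_in (dual S) E \<longleftrightarrow> unbounded_in S E"
  by (cases S) auto

lemma b_num_dual: "b_num (dual S) = d_num S"
  by (simp add: b_num_def d_num_def unbounded_in_dual)

lemma d_num_dual: "d_num (dual S) = b_num S"
  by (simp add: b_num_def d_num_def dominating_in_dual)

lemma min_card_mono:
  assumes "\<A> \<noteq> {}" and "\<And>A. A \<in> \<A> \<Longrightarrow> \<exists>B\<in>\<B>. |B| \<le>o |A|"
  shows "min_card \<B> \<le>o min_card \<A>"
proof -
  obtain A where A: "A \<in> \<A>" "min_card \<A> = |A|" using min_card(1)[OF assms(1)] by blast
  then obtain B where B: "B \<in> \<B>" "|B| \<le>o |A|" using assms(2) by blast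
  then have "min_card \<B> \<le>o |B|" using min_card(2)[of \<B>] by blast
  then show ?thesis using B(2) A(2) ordLeq_transitive by metis
qed

text \<open>
  A connection carries dominating families backwards and unbounded families forwards, and images
  never have larger cardinality.
\<close>

lemma tukey_le_invariants:
  assumes "tukey_le S T"
  shows "dominating_in T E \<Longrightarrow> d_num S \<le>o d_num T"
    and "unbounded_in S F \<Longrightarrow> b_num T \<le>o b_num S"
proof -
  obtain X Y R X' Y' R' where ST: "S = (X, Y, R)" "T = (X', Y', R')"
    by (metis prod_cases3)
  obtain \<phi> \<psi> where \<phi>: "\<forall>x\<in>X. \<phi> x \<in> X'" and \<psi>: "\<forall>y\<in>Y'. \<psi> y \<in> Y"
    and conn: "\<forall>x\<in>X. \<forall>y\<in>Y'. R' (\<phi> x) y \<longrightarrow> R x (\<psi> y)"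
    using assms unfolding ST tukey_le.simps by blast
  have dom: "dominating_in S (\<psi> ` E)" if "dominating_in T E" for E
    using that \<phi> \<psi> conn unfolding ST dominating_in.simps by blast
  have unb: "unbounded_in T (\<phi> ` F)" if "unbounded_in S F" for F
    using that \<phi> \<psi> conn unfolding ST unbounded_in.simps bounded_in.simps by blast
  show "d_num S \<le>o d_num T" if "dominating_in T E"
    unfolding d_num_def
    by (rule min_card_mono) (use that dom card_of_image in \<open>blast+\<close>)
  show "b_num T \<le>o b_num S" if "unbounded_in S F"
    unfolding b_num_def
    by (rule min_card_mono) (use that unb card_of_image in \<open>blast+\<close>)
qed

section \<open>Sparse sets from increasing functions\<close>

text \<open>The successor guarantees strict growth even where \<open>y\<close> has fixed points.\<close>

definition orbit :: "(nat \<Rightarrow> nat) \<Rightarrow> nat \<Rightarrow> nat" where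
  "orbit y n = ((\<lambda>m. Suc (y m)) ^^ n) 0"

lemma orbit_Suc: "orbit y (Suc n) = Suc (y (orbit y n))"
  by (simp add: orbit_def)

lemma strict_mono_orbit:
  assumes "strict_mono y"
  shows "strict_mono (orbit y)"
  unfolding strict_mono_Suc_iff orbit_Suc
  using assms by (simp add: strict_mono_imp_increasing le_imp_less_Suc)

lemma infinite_range_orbit: "strict_mono y \<Longrightarrow> infinite (range (orbit y))"
  using strict_mono_imp_inj_on[OF strict_mono_orbit] range_inj_infinite by blast

text \<open>After a point \<open>a \<ge> l\<close> of the orbit, the next one is \<open>y a + 1\<close>, already beyond \<open>y l\<close>.\<close>

lemma card_orbit_le_1:
  assumes y: "strict_mono y" and r: "r \<le> Suc (y l)"
  shows "card ({l..<r} \<inter> range (orbit y)) \<le> 1"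
proof -
  have False if "l \<le> orbit y i" "orbit y j < r" "orbit y i < orbit y j" for i j
  proof -
    have "Suc i \<le> j"
      using that(3) strict_mono_less[OF strict_mono_orbit[OF y]] by (simp add: Suc_le_eq)
    then have "orbit y (Suc i) \<le> orbit y j"
      using strict_mono_less_eq[OF strict_mono_orbit[OF y]] by simp
    moreover have "y l \<le> y (orbit y i)" using that(1) strict_mono_less_eq[OF y] by simp
    ultimately show False using that(2) r by (simp add: orbit_Suc)
  qed
  then have "a = b" if "a \<in> {l..<r} \<inter> range (orbit y)" "b \<in> {l..<r} \<inter> range (orbit y)" for a b
    using that by (cases a b rule: linorder_cases) auto
  then show ?thesis by (simp add: card_le_Suc0_iff_eq)
qed

text \<open>
  The condition at \<open>f n\<close> serves eventual dominance, where a late interval of \<open>f\<close> is given; the last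
  one serves exceeding infinitely often, where only a place \<open>m\<close> is given and an interval must be found.
\<close>

definition outgrows :: "(nat \<Rightarrow> nat) \<Rightarrow> (nat \<Rightarrow> nat) \<Rightarrow> bool" where
  "outgrows f x \<longleftrightarrow> strict_mono x \<and> (\<forall>n. f (Suc n) \<le> x (f n)) \<and>
     (\<forall>m. \<exists>n\<ge>m. m \<le> f n \<and> f (Suc n) \<le> x m)"

lemma omega_up_at_top:
  assumes "f \<in> omega_up"
  shows "filterlim f at_top sequentially"
proof -
  have "\<forall>\<^sub>F n in sequentially. 1 \<le> int (f (Suc n)) - int (f n)"
    using assms by (auto simp: omega_up_def filterlim_at_top)
  then obtain N where N: "f n < f (Suc n)" if "n \<ge> N" for n
    by (force simp: eventually_sequentially)
  have "strict_mono (\<lambda>n. f (n + N))"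
    by (simp add: strict_mono_Suc_iff N)
  then have "filterlim (\<lambda>n. f (n + N)) at_top sequentially"
    by (rule filterlim_subseq)
  then show ?thesis
    unfolding filterlim_at_top eventually_sequentially
    by (metis le_add_diff_inverse2 add_leD2 add_le_imp_le_right)
qed

text \<open>
  Since \<open>f\<close> tends to infinity, its values exceed \<open>m\<close> from some index on; it suffices that \<open>x m\<close>
  bounds all values of \<open>f\<close> up to just past that index.
\<close>

lemma ex_outgrows:
  assumes "f \<in> omega_up"
  shows "\<exists>x. outgrows f x"
proof -
  have "\<exists>N\<ge>m. \<forall>i\<ge>N. m < f i" for m
  proof -
    obtain N where "\<forall>i\<ge>N. Suc m \<le> f i"
      using omega_up_at_top[OF assms] unfolding filterlim_at_top eventually_sequentially by blast
    then show ?thesis by (intro exI[of _ "max N m"]) auto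
  qed
  then obtain N where N: "\<And>m. m \<le> N m" "\<And>m i. N m \<le> i \<Longrightarrow> m < f i" by metis
  define g where "g m = (\<Sum>i\<le>Suc (N m). f i)" for m
  define x where "x m = (\<Sum>j\<le>m. Suc (g j))" for m
  have x_bound: "f i \<le> x m" if "i \<le> Suc (N m)" for i m
  proof -
    have "f i \<le> g m" unfolding g_def using that by (intro member_le_sum) auto
    also have "\<dots> \<le> (\<Sum>j\<le>m. g j)" by (intro member_le_sum) auto
    also have "\<dots> \<le> x m" unfolding x_def by (intro sum_mono) auto
    finally show ?thesis .
  qed
  have "strict_mono x" by (simp add: strict_mono_Suc_iff x_def)
  moreover have "f (Suc n) \<le> x (f n)" for n
  proof (rule x_bound)
    have "\<not> N (f n) \<le> n" using N(2) by blast
    then show "Suc n \<le> Suc (N (f n))" by simp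
  qed
  moreover have "\<exists>n\<ge>m. m \<le> f n \<and> f (Suc n) \<le> x m" for m
    using N[of m] x_bound[of "Suc (N m)" m] by (intro exI[of _ "N m"]) (auto intro: less_imp_le)
  ultimately show ?thesis unfolding outgrows_def by blast
qed

lemma dominated_imp_almost_all_sparse:
  assumes f: "f \<in> omega_up" and x: "outgrows f x"
    and y: "strict_mono y" and dom: "\<forall>\<^sub>\<infinity>n. x n \<le> y n"
  shows "\<forall>\<^sub>\<infinity>n. card ({f n..<f (Suc n)} \<inter> range (orbit y)) \<le> 1"
proof -
  have "\<forall>\<^sub>\<infinity>n. x (f n) \<le> y (f n)"
    using dom omega_up_at_top[OF f] unfolding cofinite_eq_sequentially
    by (rule eventually_compose_filterlim)
  then show ?thesis
  proof (rule eventually_mono)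
    fix n assume "x (f n) \<le> y (f n)"
    then have "f (Suc n) \<le> Suc (y (f n))"
      using x unfolding outgrows_def by (meson le_trans le_SucI)
    then show "card ({f n..<f (Suc n)} \<inter> range (orbit y)) \<le> 1" by (rule card_orbit_le_1[OF y])
  qed
qed

lemma exceeded_imp_infinitely_many_sparse:
  assumes x: "outgrows f x" and y: "strict_mono y" and exc: "\<not> (\<forall>\<^sub>\<infinity>n. y n \<le> x n)"
  shows "\<exists>\<^sub>\<infinity>n. card ({f n..<f (Suc n)} \<inter> range (orbit y)) \<le> 1"
  unfolding INFM_nat_le
proof
  fix N
  obtain m where m: "m \<ge> N" "x m < y m"
    using exc unfolding MOST_nat_le by (meson not_le)
  obtain n where n: "n \<ge> m" "m \<le> f n" "f (Suc n) \<le> x m"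
    using x unfolding outgrows_def by blast
  have "y m \<le> y (f n)" using n(2) strict_mono_less_eq[OF y] by simp
  then have "f (Suc n) \<le> Suc (y (f n))" using n m by simp
  then have "card ({f n..<f (Suc n)} \<inter> range (orbit y)) \<le> 1" by (rule card_orbit_le_1[OF y])
  then show "\<exists>n\<ge>N. card ({f n..<f (Suc n)} \<inter> range (orbit y)) \<le> 1"
    using n m le_trans by blast
qed

theorem tukey_le_R_all_D: "tukey_le R_all_bd D_sys"
proof -
  obtain \<phi> where \<phi>: "\<forall>f\<in>omega_up. outgrows f (\<phi> f)"
    using bchoice[of omega_up outgrows] ex_outgrows by blast
  show ?thesis
    unfolding R_all_bd_def D_sys_def tukey_le.simps
  proof (intro exI[of _ \<phi>] exI[of _ "\<lambda>y. range (orbit y)"] conjI ballI impI)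
    fix f assume f: "f \<in> omega_up"
    then show "\<phi> f \<in> {x. strict_mono x}" using \<phi> by (auto simp: outgrows_def)
    fix y :: "nat \<Rightarrow> nat" assume "y \<in> {y. strict_mono y}" "\<forall>\<^sub>\<infinity>n. \<phi> f n \<le> y n"
    then show "\<exists>k. \<forall>\<^sub>\<infinity>n. card ({f n..<f (Suc n)} \<inter> range (orbit y)) \<le> k"
      using dominated_imp_almost_all_sparse[OF f] \<phi> f by blast
  qed (simp add: infinite_range_orbit)
qed

theorem tukey_le_R_ex_dual_D: "tukey_le R_ex_bd (dual D_sys)"
proof -
  obtain \<phi> where \<phi>: "\<forall>f\<in>omega_up. outgrows f (\<phi> f)"
    using bchoice[of omega_up outgrows] ex_outgrows by blast
  show ?thesis
    unfolding R_ex_bd_def D_sys_def dual.simps tukey_le.simps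
  proof (intro exI[of _ \<phi>] exI[of _ "\<lambda>y. range (orbit y)"] conjI ballI impI)
    fix f assume f: "f \<in> omega_up"
    then show "\<phi> f \<in> {x. strict_mono x}" using \<phi> by (auto simp: outgrows_def)
    fix y :: "nat \<Rightarrow> nat" assume "y \<in> {y. strict_mono y}" "\<not> (\<forall>\<^sub>\<infinity>n. y n \<le> \<phi> f n)"
    then show "\<exists>k. \<exists>\<^sub>\<infinity>n. card ({f n..<f (Suc n)} \<inter> range (orbit y)) \<le> k"
      using exceeded_imp_infinitely_many_sparse \<phi> f by blast
  qed (simp add: infinite_range_orbit)
qed

section \<open>Increasing functions from infinite sets\<close>

definition crowding :: "nat set \<Rightarrow> nat \<Rightarrow> nat" where
  "crowding A m = enumerate A (2 * m)"

lemma strict_mono_crowding: "infinite A \<Longrightarrow> strict_mono (crowding A)"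
  using strict_mono_enumerate[of A] by (simp add: strict_mono_def crowding_def)

text \<open>
  The points of \<open>A\<close> with indices from \<open>m\<close> to \<open>2 m - 1\<close> lie in the interval, as the \<open>i\<close>-th point is
  at least \<open>i\<close>.
\<close>

lemma card_crowding:
  assumes A: "infinite A"
  shows "m \<le> card ({m..<crowding A m} \<inter> A)"
proof -
  have sm: "strict_mono (enumerate A)" using A by (rule strict_mono_enumerate)
  have "enumerate A ` {m..<2 * m} \<subseteq> {m..<crowding A m} \<inter> A"
    using sm A by (auto simp: crowding_def strict_mono_less enumerate_in_set
      intro: order.trans[OF _ strict_mono_imp_increasing[OF sm]])
  then have "card (enumerate A ` {m..<2 * m}) \<le> card ({m..<crowding A m} \<inter> A)"
    by (intro card_mono) auto
  moreover have "card (enumerate A ` {m..<2 * m}) = m"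
    by (subst card_image) (use strict_mono_imp_inj_on[OF sm] in \<open>auto intro: inj_on_subset\<close>)
  ultimately show ?thesis by simp
qed

text \<open>The summand \<open>n + 1\<close> makes the interval lengths tend to infinity.\<close>

primrec leaps :: "(nat \<Rightarrow> nat) \<Rightarrow> nat \<Rightarrow> nat" where
  "leaps x 0 = 0"
| "leaps x (Suc n) = leaps x n + x (leaps x n) + Suc n"

lemma strict_mono_leaps: "strict_mono (leaps x)"
  by (simp add: strict_mono_Suc_iff)

lemma leaps_omega_up: "leaps x \<in> omega_up"
  unfolding omega_up_def
  by (auto intro: filterlim_at_top_mono[OF filterlim_int_sequentially])

lemma leaps_bracket:
  obtains n where "leaps x n \<le> m" "m < leaps x (Suc n)"
proof -
  have "\<exists>n. leaps x n \<le> m \<and> m < leaps x (Suc n)"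
  proof (rule ccontr)
    assume "\<not> ?thesis"
    then have "leaps x n \<le> m" for n by (induction n) (simp, metis not_le)
    then show False
      using strict_mono_imp_increasing[OF strict_mono_leaps, of "Suc m" x] not_less_eq_eq le_trans
      by blast
  qed
  with that show ?thesis by blast
qed

text \<open>
  If the function of \<open>A\<close> were dominated, \<open>[l, crowding A l)\<close> would fit into the interval starting
  at \<open>l = leaps x n\<close> for all large \<open>n\<close>, and force more than \<open>k\<close> points into it.
\<close>

lemma infinitely_many_sparse_imp_exceeded:
  assumes A: "infinite A" and k: "\<exists>\<^sub>\<infinity>n. card ({leaps x n..<leaps x (Suc n)} \<inter> A) \<le> k"
  shows "\<not> (\<forall>\<^sub>\<infinity>n. crowding A n \<le> x n)"
proof
  assume "\<forall>\<^sub>\<infinity>n. crowding A n \<le> x n"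
  then obtain M where M: "\<And>m. m \<ge> M \<Longrightarrow> crowding A m \<le> x m" unfolding MOST_nat_le by blast
  obtain n where n: "n \<ge> max M (Suc k)" "card ({leaps x n..<leaps x (Suc n)} \<inter> A) \<le> k"
    using k unfolding INFM_nat_le by blast
  define l where "l = leaps x n"
  have l: "n \<le> l" unfolding l_def by (rule strict_mono_imp_increasing[OF strict_mono_leaps])
  have "{l..<crowding A l} \<inter> A \<subseteq> {leaps x n..<leaps x (Suc n)} \<inter> A"
    using M[of l] n l by (auto simp flip: l_def)
  then have "card ({l..<crowding A l} \<inter> A) \<le> card ({leaps x n..<leaps x (Suc n)} \<inter> A)"
    by (intro card_mono) auto
  with card_crowding[OF A, of l] n l show False by simp
qed

text \<open>
  A place \<open>m\<close> in the \<open>n\<close>-th interval satisfies \<open>x m \<le> leaps x (n + 2)\<close>. If \<open>crowding A m < x m\<close>, then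
  two consecutive intervals together contain at least \<open>m\<close> points, which is too many as soon as \<open>m > 2 k\<close>.
\<close>

lemma almost_all_sparse_imp_dominated:
  assumes A: "infinite A" and x: "strict_mono x"
    and k: "\<forall>\<^sub>\<infinity>n. card ({leaps x n..<leaps x (Suc n)} \<inter> A) \<le> k"
  shows "\<forall>\<^sub>\<infinity>n. x n \<le> crowding A n"
proof -
  obtain N where N: "\<And>n. n \<ge> N \<Longrightarrow> card ({leaps x n..<leaps x (Suc n)} \<inter> A) \<le> k"
    using k unfolding MOST_nat_le by blast
  have "x m \<le> crowding A m" if m: "m \<ge> max (leaps x N) (Suc (2 * k))" for m
  proof (rule ccontr)
    assume "\<not> x m \<le> crowding A m"
    obtain n where n: "leaps x n \<le> m" "m < leaps x (Suc n)" by (rule leaps_bracket)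
    have "leaps x N < leaps x (Suc n)" using n m by simp
    then have Nn: "N \<le> n" unfolding strict_mono_less[OF strict_mono_leaps] by simp
    let ?I = "{leaps x n..<leaps x (Suc n)} \<inter> A"
    let ?J = "{leaps x (Suc n)..<leaps x (Suc (Suc n))} \<inter> A"
    have "x m \<le> x (leaps x (Suc n))" using n strict_mono_less_eq[OF x] by simp
    also have "\<dots> \<le> leaps x (Suc (Suc n))" by simp
    finally have "{m..<crowding A m} \<inter> A \<subseteq> ?I \<union> ?J"
      using n \<open>\<not> x m \<le> crowding A m\<close> by auto
    then have "card ({m..<crowding A m} \<inter> A) \<le> card (?I \<union> ?J)"
      by (intro card_mono) auto
    also have "\<dots> \<le> card ?I + card ?J" by (rule card_Un_le)
    also have "\<dots> \<le> 2 * k" using N[of n] N[of "Suc n"] Nn by simp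
    finally show False using card_crowding[OF A, of m] m by simp
  qed
  then show ?thesis unfolding MOST_nat_le by blast
qed

theorem tukey_le_D_R_all: "tukey_le D_sys R_all_bd"
  unfolding R_all_bd_def D_sys_def tukey_le.simps
  by (intro exI[of _ leaps] exI[of _ crowding])
    (auto simp: leaps_omega_up strict_mono_crowding simp del: leaps.simps
          intro: almost_all_sparse_imp_dominated)

theorem tukey_le_dual_D_R_ex: "tukey_le (dual D_sys) R_ex_bd"
  unfolding R_ex_bd_def D_sys_def dual.simps tukey_le.simps
  by (intro exI[of _ leaps] exI[of _ crowding])
    (use infinitely_many_sparse_imp_exceeded in
      \<open>auto simp: leaps_omega_up strict_mono_crowding simp del: leaps.simps\<close>)

section \<open>The values of the invariants\<close>

theorem theoremF:
  shows "b_num R_ex_bd =o d_num D_sys \<and> d_num R_ex_bd =o b_num D_sys \<and>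
         d_num R_all_bd =o d_num D_sys \<and> b_num R_all_bd =o b_num D_sys"
proof -
  have dual_D: "unbounded_in (dual D_sys) {y. strict_mono y}"
    "dominating_in (dual D_sys) {x. strict_mono x}"
    by (simp_all add: unbounded_in_dual dominating_in_dual dominating_D_sys unbounded_D_sys)
  note le = tukey_le_invariants
  have "b_num R_ex_bd =o d_num D_sys"
    using le(2)[OF tukey_le_R_ex_dual_D unbounded_R_ex_bd] le(2)[OF tukey_le_dual_D_R_ex dual_D(1)]
    by (simp add: b_num_dual ordIso_iff_ordLeq)
  moreover have "d_num R_ex_bd =o b_num D_sys"
    using le(1)[OF tukey_le_R_ex_dual_D dual_D(2)] le(1)[OF tukey_le_dual_D_R_ex dominating_R_ex_bd]
    by (simp add: d_num_dual ordIso_iff_ordLeq)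
  moreover have "d_num R_all_bd =o d_num D_sys"
    using le(1)[OF tukey_le_R_all_D dominating_D_sys] le(1)[OF tukey_le_D_R_all dominating_R_all_bd]
    by (simp add: ordIso_iff_ordLeq)
  moreover have "b_num R_all_bd =o b_num D_sys"
    using le(2)[OF tukey_le_R_all_D unbounded_R_all_bd] le(2)[OF tukey_le_D_R_all unbounded_D_sys]
    by (simp add: ordIso_iff_ordLeq)
  ultimately show ?thesis by blast
qed

end
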